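(* The metric $d_N:\mathcal H_\Omega\times\mathcal H_\Omega\to\mathbb R$ on the infinite-dimensional Heisenberg group $\mathcal H_\Omega$ is conditionally of negative type.
   Context: Let $H_{\mathbb C}$ be an infinite-dimensional complex Hilbert space with symplectic form $\Omega(a,b)=\operatorname{Im}\langle a,b\rangle$. The infinite-dimensional Heisenberg group $\mathcal H_\Omega$ is the set of pairs $(a,t)$, $a\in H_{\mathbb C}$, $t\in\mathbb R$, with group law $(a,t)(a',t')=(a+a',t+t'+2\,\Omega(a,a'))$ (and the product topology). The function $$N(a,t)=\sqrt{\sqrt{\|a\|^4+t^2}+\|a\|^2}$$ is a group norm on $\mathcal H_\Omega$, and $d_N(g,h)=N(gh^{-1})$ is the associated right-invariant metric. A continuous real-valued kernel $K:X\times X\to\mathbb R$ on a topological space $X$ is conditionally of negative type if $K(x,x)=0$ for all $x$, $K(x,y)=K(y,x)$ for all $x,y$, and $\sum_{i=1}^n\sum_{j=1}^nc_ic_jK(x_i,x_j)\le0$ for all $n\in\mathbb N$, all $x_1,\dots,x_n\in X$ and all real $c_1,\dots,c_n$ with $\sum_ic_i=0$. *)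

theory Defs
  imports "HOL-Analysis.Analysis" "HOL-Algebra.Group"
begin

(* Complex Hilbert spaces.  The scalar multiplication by reals, the norm, the topology and
   completeness come from class banach; the axioms tie them to the complex structure.
   The inner product is linear in the first argument and conjugate-linear in the second;
   axiom cinner_self says that it is positive definite and induces the norm. *)
class complex_hilbert = banach +
  fixes scaleC :: "complex \<Rightarrow> 'a \<Rightarrow> 'a" (infixr "*\<^sub>C" 75)
    and cinner :: "'a \<Rightarrow> 'a \<Rightarrow> complex"
  assumes scaleC_add_right: "c *\<^sub>C (x + y) = c *\<^sub>C x + c *\<^sub>C y"
    and scaleC_add_left: "(c + d) *\<^sub>C x = c *\<^sub>C x + d *\<^sub>C x"
    and scaleC_scaleC: "c *\<^sub>C d *\<^sub>C x = (c * d) *\<^sub>C x"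
    and scaleC_one: "1 *\<^sub>C x = x"
    and scaleR_scaleC: "r *\<^sub>R x = complex_of_real r *\<^sub>C x"
    and cinner_add_left: "cinner (x + y) z = cinner x z + cinner y z"
    and cinner_scaleC_left: "cinner (c *\<^sub>C x) y = c * cinner x y"
    and cinner_commute: "cinner x y = cnj (cinner y x)"
    and cinner_self: "cinner x x = complex_of_real ((norm x)\<^sup>2)"

lemma vector_space_scaleC: "vector_space (scaleC :: complex \<Rightarrow> 'a \<Rightarrow> 'a::complex_hilbert)"
  by unfold_locales (simp_all add: scaleC_add_right scaleC_add_left scaleC_scaleC scaleC_one)

definition Omega :: "'a::complex_hilbert \<Rightarrow> 'a \<Rightarrow> real" where
  "Omega a b = Im (cinner a b)"

(* The underlying type carries the product topology; its componentwise group operations from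
   the type class instance for products are not those of the Heisenberg group. *)
definition heisenberg :: "('a::complex_hilbert \<times> real) monoid" where
  "heisenberg = \<lparr>carrier = UNIV,
     mult = (\<lambda>(a, t) (a', t'). (a + a', t + t' + 2 * Omega a a')),
     one = (0, 0)\<rparr>"

definition heisenberg_norm :: "'a::complex_hilbert \<times> real \<Rightarrow> real" where
  "heisenberg_norm = (\<lambda>(a, t). sqrt (sqrt (norm a ^ 4 + t\<^sup>2) + (norm a)\<^sup>2))"

definition heisenberg_dist ::
  "'a::complex_hilbert \<times> real \<Rightarrow> 'a \<times> real \<Rightarrow> real" where
  "heisenberg_dist g h = heisenberg_norm (g \<otimes>\<^bsub>heisenberg\<^esub> inv\<^bsub>heisenberg\<^esub> h)"

definition conditionally_negative_type ::
  "('x::topological_space \<Rightarrow> 'x \<Rightarrow> real) \<Rightarrow> bool" where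
  "conditionally_negative_type K \<longleftrightarrow>
     continuous_on UNIV (\<lambda>(x, y). K x y) \<and>
     (\<forall>x. K x x = 0) \<and>
     (\<forall>x y. K x y = K y x) \<and>
     (\<forall>(n::nat) (x :: nat \<Rightarrow> 'x) (c :: nat \<Rightarrow> real).
        (\<Sum>i=1..n. c i) = 0 \<longrightarrow> (\<Sum>i=1..n. \<Sum>j=1..n. c i * c j * K (x i) (x j)) \<le> 0)"

lemma Omega_add_left: "Omega (a + b) c = Omega a c + Omega b c"
  by (simp add: Omega_def cinner_add_left)

lemma Omega_swap: "Omega a b = - Omega b a"
  unfolding Omega_def by (subst cinner_commute) simp

lemma Omega_add_right: "Omega c (a + b) = Omega c a + Omega c b"
  using Omega_swap[of c "a + b"] Omega_swap[of c a] Omega_swap[of c b]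
  by (simp add: Omega_add_left)

lemma Omega_self: "Omega a a = 0"
  by (simp add: Omega_def cinner_self)

lemma Omega_zero_left: "Omega 0 a = 0"
  using Omega_add_left[of 0 0 a] by simp

lemma Omega_minus_left: "Omega (- a) b = - Omega a b"
  using Omega_add_left[of a "- a" b] by (simp add: Omega_zero_left)

lemma group_heisenberg: "group (heisenberg :: ('a::complex_hilbert \<times> real) monoid)"
proof (rule groupI)
  fix g :: "'a \<times> real"
  obtain a t where g: "g = (a, t)" by force
  show "\<exists>h\<in>carrier heisenberg. h \<otimes>\<^bsub>heisenberg\<^esub> g = \<one>\<^bsub>heisenberg\<^esub>"
    by (rule bexI[of _ "(- a, - t)"])
      (simp_all add: heisenberg_def g Omega_minus_left Omega_self)
qed (auto simp: heisenberg_def Omega_add_left Omega_add_right Omega_zero_left)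

lemma inv_heisenberg: "inv\<^bsub>heisenberg\<^esub> (a, t) = (- a, - t)"
  by (rule group.inv_equality[OF group_heisenberg])
    (simp_all add: heisenberg_def Omega_minus_left Omega_self)

end

theory Submission imports Defs begin

(* With w(g, h) = |a|^2 + |b|^2 - 2<a, b> + i (t - s), where g = (a, t) and h = (b, s), one has
   d_N(g, h) = sqrt 2 * Re (csqrt (w(g, h))).  The kernels exp (- s w), s >= 0, are positive
   semidefinite: they are rank-one multiples of exp (2 s <a, b>), which is a power series with
   nonnegative coefficients in a Gram matrix.  For a positive semidefinite kernel E with |E| < 1
   all coefficients but the constant one of the binomial series of sqrt (1 - E) are nonpositive,
   so Re (csqrt (1 - E)) is conditionally of negative type.  Finally csqrt w is the limit of
   csqrt ((1 - exp (- s w)) / s) as s tends to 0. *)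

section \<open>Positive semidefinite kernels\<close>

text \<open>Only the real part of the quadratic form is constrained, so for finite \<open>I\<close>
  this says that the Hermitian part of the kernel is positive semidefinite; no symmetry has to be
  carried along.\<close>

definition psd_on :: "'i set \<Rightarrow> ('i \<Rightarrow> 'i \<Rightarrow> complex) \<Rightarrow> bool" where
  "psd_on I K \<longleftrightarrow> (\<forall>c. 0 \<le> Re (\<Sum>i\<in>I. \<Sum>j\<in>I. c i * cnj (c j) * K i j))"

lemma psd_onD: "psd_on I K \<Longrightarrow> 0 \<le> Re (\<Sum>i\<in>I. \<Sum>j\<in>I. c i * cnj (c j) * K i j)"
  by (simp add: psd_on_def)

lemma psd_on_one: "psd_on I (\<lambda>i j. 1)"
proof -
  have "(\<Sum>i\<in>I. \<Sum>j\<in>I. c i * cnj (c j) * 1) = of_real ((norm (sum c I))\<^sup>2)"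
    for c :: "'a \<Rightarrow> complex"
    unfolding complex_norm_square by (simp add: sum_product)
  then show ?thesis
    unfolding psd_on_def by simp
qed

lemma psd_on_scale:
  assumes "psd_on I K"
  shows "psd_on I (\<lambda>i j. f i * cnj (f j) * K i j)"
  unfolding psd_on_def
proof
  fix c
  show "0 \<le> Re (\<Sum>i\<in>I. \<Sum>j\<in>I. c i * cnj (c j) * (f i * cnj (f j) * K i j))"
    using psd_onD[OF assms, of "\<lambda>i. c i * f i"] by (simp add: mult_ac)
qed

lemma psd_on_add:
  assumes "psd_on I K" "psd_on I L"
  shows "psd_on I (\<lambda>i j. K i j + L i j)"
  using assms by (simp add: psd_on_def distrib_left sum.distrib)

lemma psd_on_of_real_mult:
  assumes "psd_on I K" "0 \<le> r"
  shows "psd_on I (\<lambda>i j. complex_of_real r * K i j)"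
  using psd_on_scale[OF assms(1), of "\<lambda>_. complex_of_real (sqrt r)"] assms(2)
  by (simp flip: of_real_mult)

lemma psd_on_sum:
  assumes "\<And>n. n \<in> A \<Longrightarrow> psd_on I (K n)"
  shows "psd_on I (\<lambda>i j. \<Sum>n\<in>A. K n i j)"
  using assms
proof (induction A rule: infinite_finite_induct)
  case (insert n A)
  then show ?case by (simp add: psd_on_add)
qed (simp_all add: psd_on_def)

lemma psd_on_LIMSEQ:
  assumes "\<And>n. psd_on I (K n)" "\<And>i j. (\<lambda>n. K n i j) \<longlonglongrightarrow> L i j"
  shows "psd_on I L"
  unfolding psd_on_def
proof
  fix c
  have "(\<lambda>n. Re (\<Sum>i\<in>I. \<Sum>j\<in>I. c i * cnj (c j) * K n i j))
      \<longlonglongrightarrow> Re (\<Sum>i\<in>I. \<Sum>j\<in>I. c i * cnj (c j) * L i j)"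
    by (intro tendsto_intros assms(2))
  then show "0 \<le> Re (\<Sum>i\<in>I. \<Sum>j\<in>I. c i * cnj (c j) * L i j)"
    using psd_onD[OF assms(1)] by (intro LIMSEQ_le_const) auto
qed

section \<open>Gram matrices\<close>

lemma cinner_scaleC_right: "cinner x (c *\<^sub>C y) = cnj c * cinner x y"
  using cinner_commute[of x "c *\<^sub>C y"] cinner_commute[of y x]
  by (simp add: cinner_scaleC_left)

lemma cinner_add_right: "cinner x (y + z) = cinner x y + cinner x z"
  using cinner_commute[of x "y + z"] cinner_commute[of y x] cinner_commute[of z x]
  by (simp add: cinner_add_left)

lemma cinner_diff_left: "cinner (x - y) z = cinner x z - cinner y z"
  using cinner_add_left[of "x - y" y z] by simp

lemma cinner_diff_right: "cinner x (y - z) = cinner x y - cinner x z"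
  using cinner_add_right[of x "y - z" z] by simp

lemma cinner_zero_left: "cinner 0 x = 0"
  using cinner_diff_left[of 0 0 x] by simp

lemma cinner_zero_right: "cinner x 0 = 0"
  using cinner_diff_right[of x 0 0] by simp

(* The components of the vectors along the peeled-off vector contribute a rank-one multiple of K;
   what remains vanishes at the peeled-off index. *)
lemma psd_on_mult_cinner:
  fixes a :: "'i \<Rightarrow> 'a::complex_hilbert"
  assumes "finite I" "psd_on I K"
  shows "psd_on I (\<lambda>i j. K i j * cinner (a i) (a j))"
proof -
  \<comment> \<open>Unit coefficients suffice: a coefficient \<open>c i\<close> can be absorbed into
    the vector \<open>a i\<close>. The vectors stay arbitrary because the induction replaces them by
    projections.\<close>
  have "0 \<le> Re (\<Sum>i\<in>I. \<Sum>j\<in>I. K i j * cinner (a i) (a j))" for a :: "'i \<Rightarrow> 'a"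
    using assms
  proof (induction I arbitrary: a)
    case (insert k I)
    \<comment> \<open>\<open>b i\<close> is the component of \<open>a i\<close> orthogonal to
      \<open>a k\<close>. If \<open>a k = 0\<close>, division by zero gives \<open>r = 0\<close>,
      and the identities in \<open>r\<close> below still hold.\<close>
    define r where "r = 1 / (norm (a k))\<^sup>2"
    define b where "b i = a i - (of_real r * cinner (a i) (a k)) *\<^sub>C a k" for i
    have r: "0 \<le> r" "of_real r * cinner (a k) (a k) * of_real r = complex_of_real r"
      by (auto simp: r_def cinner_self power2_eq_square)
    have b0: "b k = 0"
    proof (cases "a k = 0")
      case True
      then show ?thesis
        using scaleR_scaleC[of 0 "0 :: 'a"] by (simp add: b_def cinner_zero_left)
    next
      case False
      then have "of_real r * cinner (a k) (a k) = 1"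
        by (simp add: r_def cinner_self)
      then show ?thesis by (simp add: b_def scaleC_one)
    qed
    have eq: "K i j * cinner (a i) (a j) =
        of_real r * (cinner (a i) (a k) * cnj (cinner (a j) (a k)) * K i j)
        + K i j * cinner (b i) (b j)" for i j
    proof -
      have "cinner (b i) (b j) = cinner (a i) (a j)
          - of_real r * (cinner (a i) (a k) * cnj (cinner (a j) (a k)))
          - of_real r * (cinner (a i) (a k) * cnj (cinner (a j) (a k)))
          + (of_real r * cinner (a k) (a k) * of_real r)
             * (cinner (a i) (a k) * cnj (cinner (a j) (a k)))"
        using cinner_commute[of "a k" "a j"]
        by (simp add: b_def cinner_diff_left cinner_diff_right cinner_scaleC_left
            cinner_scaleC_right algebra_simps)
      then have "cinner (a i) (a j) = cinner (b i) (b j)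
          + of_real r * (cinner (a i) (a k) * cnj (cinner (a j) (a k)))"
        unfolding r by (simp add: algebra_simps)
      then show ?thesis by (simp add: algebra_simps)
    qed
    \<comment> \<open>Coefficients on \<open>I\<close> are padded with zero at \<open>k\<close>, so
      positivity passes to the smaller index set.\<close>
    have "psd_on I K"
      unfolding psd_on_def
    proof
      fix c :: "'i \<Rightarrow> complex"
      have "(\<Sum>i\<in>I. \<Sum>j\<in>I. c i * cnj (c j) * K i j) =
          (\<Sum>i\<in>insert k I. \<Sum>j\<in>insert k I. (c(k := 0)) i * cnj ((c(k := 0)) j) * K i j)"
        using insert.hyps by (auto intro!: sum.cong)
      then show "0 \<le> Re (\<Sum>i\<in>I. \<Sum>j\<in>I. c i * cnj (c j) * K i j)"
        using psd_onD[OF insert.prems, of "c(k := 0)"] by simp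
    qed
    then have "0 \<le> Re (\<Sum>i\<in>I. \<Sum>j\<in>I. K i j * cinner (b i) (b j))"
      by (rule insert.IH)
    also have "(\<Sum>i\<in>I. \<Sum>j\<in>I. K i j * cinner (b i) (b j)) =
        (\<Sum>i\<in>insert k I. \<Sum>j\<in>insert k I. K i j * cinner (b i) (b j))"
      using insert.hyps by (simp add: b0 cinner_zero_left cinner_zero_right)
    finally have "0 \<le> Re (\<Sum>i\<in>insert k I. \<Sum>j\<in>insert k I. K i j * cinner (b i) (b j))" .
    moreover have "0 \<le> r * Re (\<Sum>i\<in>insert k I. \<Sum>j\<in>insert k I.
        cinner (a i) (a k) * cnj (cinner (a j) (a k)) * K i j)"
      using psd_onD[OF insert.prems] r(1) by (intro mult_nonneg_nonneg)
    ultimately show ?case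
      unfolding eq sum.distrib sum_distrib_left[symmetric] by simp
  qed simp
  from this[of "\<lambda>i. _ i *\<^sub>C a i"] show ?thesis
    by (simp add: psd_on_def cinner_scaleC_left cinner_scaleC_right mult_ac)
qed

lemma psd_on_cinner_power:
  assumes "finite I"
  shows "psd_on I (\<lambda>i j. cinner (a i) (a j) ^ n)"
proof (induction n)
  case (Suc n)
  then show ?case
    using psd_on_mult_cinner[OF assms Suc, of a] by (simp add: mult.commute)
qed (simp add: psd_on_one)

lemma psd_on_exp_cinner:
  assumes "finite I" "0 \<le> r"
  shows "psd_on I (\<lambda>i j. exp (of_real r * cinner (a i) (a j)))"
proof (rule psd_on_LIMSEQ)
  fix n
  show "psd_on I (\<lambda>i j. \<Sum>k<n. of_real (r ^ k / fact k) * cinner (a i) (a j) ^ k)"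
    using assms by (intro psd_on_sum psd_on_of_real_mult psd_on_cinner_power) auto
next
  fix i j
  have "(\<lambda>k. (of_real r * cinner (a i) (a j)) ^ k /\<^sub>R fact k)
      sums exp (of_real r * cinner (a i) (a j))"
    by (rule exp_converges)
  also have "(\<lambda>k. (of_real r * cinner (a i) (a j)) ^ k /\<^sub>R fact k) =
      (\<lambda>k. of_real (r ^ k / fact k) * cinner (a i) (a j) ^ k)"
    by (simp add: fun_eq_iff power_mult_distrib scaleR_conv_of_real divide_inverse mult_ac)
  finally show "(\<lambda>n. \<Sum>k<n. of_real (r ^ k / fact k) * cinner (a i) (a j) ^ k)
      \<longlonglongrightarrow> exp (of_real r * cinner (a i) (a j))"
    by (simp add: sums_def)
qed

section \<open>Square roots\<close>

text \<open>This is the binomial series with exponent 1/2 at \<open>- z\<close>. The sign from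
  rewriting the binomial coefficient as a Pochhammer symbol cancels that of
  \<open>(- z) ^ n\<close>.\<close>

lemma csqrt_one_minus_sums:
  assumes "norm z < 1"
  shows "(\<lambda>n. of_real (pochhammer (- 1 / 2) n / fact n) * z ^ n) sums csqrt (1 - z)"
proof -
  have "(1 / 2 gchoose n) * (- z) ^ n = of_real (pochhammer (- 1 / 2) n / fact n) * z ^ n" for n
  proof -
    have "pochhammer (- (1 / 2)) n = complex_of_real (pochhammer (- 1 / 2) n)"
      by (simp flip: pochhammer_of_real)
    moreover have "(- 1) ^ n * (- z) ^ n = z ^ n"
      by (simp flip: power_mult_distrib)
    ultimately show ?thesis by (simp add: gbinomial_pochhammer mult_ac)
  qed
  then show ?thesis
    using gen_binomial_complex[of "- z" "1 / 2"] assms by (simp add: csqrt_conv_powr)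
qed

text \<open>The first factor is -1/2, and the remaining ones 1/2, 3/2, ... are positive.\<close>

lemma pochhammer_minus_half_nonpos: "pochhammer (- 1 / 2 :: real) (Suc n) \<le> 0"
  using pochhammer_nonneg[of "1 / 2 :: real" n] by (simp add: pochhammer_rec)

text \<open>The branch cut of \<open>csqrt\<close> affects only the imaginary part: the real part is
  the root of \<open>(cmod z + Re z) / 2\<close>. Limits can thus be taken without avoiding the
  negative axis.\<close>

lemma continuous_Re_csqrt: "isCont (\<lambda>z. Re (csqrt z)) z"
  unfolding csqrt.simps by (intro continuous_intros) auto

text \<open>Positivity is assumed for every power of \<open>E\<close>, matching the terms of the
  binomial series; for exponential kernels the powers are again exponentials of the same
  family.\<close>

lemma sum_Re_csqrt_one_minus_le:
  fixes c :: "'i \<Rightarrow> real"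
  assumes psd: "\<And>n. psd_on I (\<lambda>i j. E i j ^ n)" and norm: "\<And>i j. norm (E i j) \<le> 1"
    and c: "sum c I = 0"
  shows "(\<Sum>i\<in>I. \<Sum>j\<in>I. c i * c j * Re (csqrt (1 - E i j))) \<le> 0"
proof -
  \<comment> \<open>The series is available only in the open unit disc, while entries of
    \<open>E\<close> may have norm 1. Hence \<open>E\<close> is damped by \<open>r < 1\<close>, and
    \<open>r\<close> tends to 1 at the end.\<close>
  define S where "S r = (\<Sum>i\<in>I. \<Sum>j\<in>I. c i * c j * Re (csqrt (1 - of_real r * E i j)))" for r
  have S: "S r \<le> 0" if r: "0 \<le> r" "r < 1" for r
  proof -
    have "(\<lambda>n. \<Sum>i\<in>I. \<Sum>j\<in>I. c i * c j *
        Re (of_real (pochhammer (- 1 / 2) n / fact n) * (of_real r * E i j) ^ n)) sums S r"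
      unfolding S_def
    proof (intro sums_sum sums_mult sums_Re csqrt_one_minus_sums)
      fix i j
      have "r * norm (E i j) \<le> r * 1"
        using norm r by (intro mult_left_mono) auto
      then show "norm (of_real r * E i j) < 1"
        using r by (simp add: norm_mult)
    qed
    moreover have "(\<Sum>i\<in>I. \<Sum>j\<in>I. c i * c j *
        Re (of_real (pochhammer (- 1 / 2) n / fact n) * (of_real r * E i j) ^ n)) \<le> 0" for n
    proof (cases n)
      \<comment> \<open>The constant term contributes the square of \<open>sum c I\<close>, which
        vanishes.\<close>
      case 0
      then show ?thesis
        using c by (simp flip: sum_product)
    next
      case (Suc m)
      have "(\<Sum>i\<in>I. \<Sum>j\<in>I. c i * c j *
          Re (of_real (pochhammer (- 1 / 2) n / fact n) * (of_real r * E i j) ^ n)) =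
        pochhammer (- 1 / 2) n / fact n * r ^ n *
          Re (\<Sum>i\<in>I. \<Sum>j\<in>I. of_real (c i) * cnj (of_real (c j)) * E i j ^ n)"
        unfolding Re_sum sum_distrib_left
        by (intro sum.cong refl)
          (simp add: power_mult_distrib mult_ac flip: of_real_mult of_real_power of_real_divide)
      also have "\<dots> \<le> 0"
      proof (intro mult_nonpos_nonneg psd_onD psd)
        show "pochhammer (- 1 / 2) n / fact n \<le> (0 :: real)"
          unfolding Suc by (intro divide_nonpos_pos pochhammer_minus_half_nonpos) simp
      qed (use r in simp)
      finally show ?thesis .
    qed
    ultimately show ?thesis
      by (intro sums_le[OF _ _ sums_zero, of _ "S r"])
  qed
  have "isCont S 1"
    unfolding S_def
    by (intro continuous_intros isCont_o2[OF _ continuous_Re_csqrt])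
  then have "(S \<longlongrightarrow> S 1) (at_left 1)"
    by (simp add: isCont_def filterlim_at_split)
  moreover have "\<forall>\<^sub>F r in at_left 1. S r \<le> 0"
    using eventually_at_left_real[of 0 "1 :: real", OF zero_less_one] by eventually_elim (auto intro: S)
  ultimately have "S 1 \<le> 0"
    by (intro tendsto_upperbound) auto
  then show ?thesis by (simp add: S_def)
qed

text \<open>The previous lemma applies to \<open>E = exp (- s w)\<close>, and
  \<open>(1 - E) / s\<close> tends to \<open>w\<close> as \<open>s\<close> decreases to 0. The bound
  on \<open>Re (w i j)\<close> keeps \<open>E\<close> in the closed unit disc.\<close>

lemma sum_Re_csqrt_le:
  fixes c :: "'i \<Rightarrow> real"
  assumes psd: "\<And>s. 0 < s \<Longrightarrow> psd_on I (\<lambda>i j. exp (- of_real s * w i j))"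
    and w: "\<And>i j. 0 \<le> Re (w i j)" and c: "sum c I = 0"
  shows "(\<Sum>i\<in>I. \<Sum>j\<in>I. c i * c j * Re (csqrt (w i j))) \<le> 0"
proof -
  define s where "s n = inverse (real (Suc n))" for n
  have s: "0 < s n" for n by (simp add: s_def)
  have s0: "s \<longlonglongrightarrow> 0"
    unfolding s_def by (rule LIMSEQ_inverse_real_of_nat)
  \<comment> \<open>These are difference quotients at 0 of \<open>1 - exp (- x * z)\<close>, whose
    derivative there is \<open>z\<close>.\<close>
  have lim: "(\<lambda>n. (1 - exp (- of_real (s n) * z)) / of_real (s n)) \<longlonglongrightarrow> z" for z :: complex
  proof -
    have "((\<lambda>x. 1 - exp (- x * z)) has_field_derivative z) (at 0)"
      by (auto intro!: derivative_eq_intros)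
    then have "((\<lambda>x. (1 - exp (- x * z)) / x) \<longlongrightarrow> z) (at 0)"
      by (simp add: has_field_derivative_iff)
    moreover have "filterlim (\<lambda>n. complex_of_real (s n)) (at 0) sequentially"
      using s tendsto_of_real[OF s0, where 'a = complex]
      by (auto simp: filterlim_at less_imp_neq[symmetric] intro!: always_eventually)
    ultimately show ?thesis
      by (rule filterlim_compose)
  qed
  have "(\<lambda>n. \<Sum>i\<in>I. \<Sum>j\<in>I. c i * c j *
      Re (csqrt ((1 - exp (- of_real (s n) * w i j)) / of_real (s n))))
      \<longlonglongrightarrow> (\<Sum>i\<in>I. \<Sum>j\<in>I. c i * c j * Re (csqrt (w i j)))"
    by (intro tendsto_intros isCont_tendsto_compose[OF continuous_Re_csqrt] lim)
  moreover have "(\<Sum>i\<in>I. \<Sum>j\<in>I. c i * c j *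
      Re (csqrt ((1 - exp (- of_real (s n) * w i j)) / of_real (s n)))) \<le> 0" for n
  proof -
    let ?E = "\<lambda>i j. exp (- of_real (s n) * w i j)"
    have "(\<Sum>i\<in>I. \<Sum>j\<in>I. c i * c j * Re (csqrt (1 - ?E i j))) \<le> 0"
    proof (rule sum_Re_csqrt_one_minus_le[OF _ _ c])
      fix k
      show "psd_on I (\<lambda>i j. ?E i j ^ k)"
      \<comment> \<open>The power 0 is separate because \<open>psd\<close> covers only positive
        parameters, here \<open>k * s n\<close>.\<close>
      proof (cases "k = 0")
        case False
        have "?E i j ^ k = exp (- of_real (of_nat k * s n) * w i j)" for i j
          by (simp add: mult.assoc flip: exp_of_nat_mult)
        then show ?thesis
          using psd[of "of_nat k * s n"] s[of n] False by simp
      qed (simp add: psd_on_one)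
    next
      fix i j
      show "norm (?E i j) \<le> 1"
        using w[of i j] s[of n] by (simp add: mult_nonneg_nonneg)
    qed
    \<comment> \<open>Dividing by the positive real \<open>s n\<close> only rescales the root by a
      positive factor, so the sign of the sum is preserved.\<close>
    moreover have "Re (csqrt (z / of_real (s n))) = Re (csqrt z) / sqrt (s n)" for z
      using s[of n]
      by (simp add: norm_divide real_sqrt_divide[symmetric] add_divide_distrib[symmetric]
          field_simps)
    ultimately show ?thesis
      using s[of n]
      by (simp add: sum_divide_distrib[symmetric] divide_nonpos_pos del: csqrt.simps)
  qed
  ultimately show ?thesis
    by (intro LIMSEQ_le_const2) auto
qed

section \<open>The Heisenberg group\<close>

lemma heisenberg_dist_eq:
  "heisenberg_dist (a, t) (b, s) =
    sqrt (sqrt (norm (a - b) ^ 4 + (t - s - 2 * Omega a b)\<^sup>2) + (norm (a - b))\<^sup>2)"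
proof -
  have "Omega a (- b) = - Omega a b"
    using Omega_swap[of a "- b"] Omega_swap[of a b] by (simp add: Omega_minus_left)
  then show ?thesis
    unfolding heisenberg_dist_def inv_heisenberg
    by (simp add: heisenberg_norm_def heisenberg_def)
qed

lemma norm_diff_sqr:
  "(norm (a - b))\<^sup>2 = (norm a)\<^sup>2 + (norm b)\<^sup>2 - 2 * Re (cinner a b)"
  for a b :: "'a::complex_hilbert"
proof -
  have "(norm (a - b))\<^sup>2 = Re (cinner (a - b) (a - b))"
    by (simp add: cinner_self)
  also have "\<dots> = (norm a)\<^sup>2 + (norm b)\<^sup>2 - Re (cinner a b) - Re (cinner b a)"
    unfolding cinner_diff_left cinner_diff_right by (simp add: cinner_self)
  also have "Re (cinner b a) = Re (cinner a b)"
    by (subst cinner_commute) simp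
  finally show ?thesis by simp
qed

text \<open>Grouped as a function of the first point plus the conjugate of the same function of the
  second, minus twice a Gram kernel, so that its exponential factors as \<open>psd_on_scale\<close>
  requires.\<close>

definition heisenberg_kernel :: "'a::complex_hilbert \<times> real \<Rightarrow> 'a \<times> real \<Rightarrow> complex" where
  "heisenberg_kernel = (\<lambda>(a, t) (b, s).
     Complex ((norm a)\<^sup>2) t + cnj (Complex ((norm b)\<^sup>2) s) - 2 * cinner a b)"

lemma Re_heisenberg_kernel:
  "Re (heisenberg_kernel (a, t) (b, s)) = (norm (a - b))\<^sup>2"
  by (simp add: heisenberg_kernel_def norm_diff_sqr)

text \<open>The modulus of the kernel is the inner root in the distance and its real part is the
  squared norm; the factor \<open>sqrt 2\<close> cancels the halving inside
  \<open>Re (csqrt z)\<close>.\<close>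

lemma heisenberg_dist_conv_kernel:
  "heisenberg_dist g h = sqrt 2 * Re (csqrt (heisenberg_kernel g h))"
proof -
  obtain a t b s where gh: "g = (a, t)" "h = (b, s)" by force
  have "cmod (heisenberg_kernel g h) = sqrt (norm (a - b) ^ 4 + (t - s - 2 * Omega a b)\<^sup>2)"
    unfolding cmod_def gh Re_heisenberg_kernel
    by (simp add: heisenberg_kernel_def Omega_def)
  then show ?thesis
    unfolding gh heisenberg_dist_eq csqrt.simps Re_heisenberg_kernel
    by (simp flip: real_sqrt_mult)
qed

lemma psd_on_exp_heisenberg_kernel:
  assumes "finite I" "0 \<le> s"
  shows "psd_on I (\<lambda>i j. exp (- of_real s * heisenberg_kernel (x i) (x j)))"
proof -
  define f where
    "f i = exp (- of_real s * Complex ((norm (fst (x i)))\<^sup>2) (snd (x i)))" for i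
  have "exp (- of_real s * heisenberg_kernel (x i) (x j)) =
      f i * cnj (f j) * exp (of_real (2 * s) * cinner (fst (x i)) (fst (x j)))" for i j
    by (simp add: f_def heisenberg_kernel_def case_prod_beta algebra_simps
        exp_cnj flip: exp_add)
  then show ?thesis
    using psd_on_scale[OF psd_on_exp_cinner[OF assms(1), of "2 * s" "\<lambda>i. fst (x i)"], of f]
      assms(2)
    by simp
qed

section \<open>Continuity of the symplectic form\<close>

lemma norm_scaleC: "norm (c *\<^sub>C x) = cmod c * norm x"
proof -
  have "complex_of_real ((norm (c *\<^sub>C x))\<^sup>2) = cinner (c *\<^sub>C x) (c *\<^sub>C x)"
    by (simp only: cinner_self)
  also have "\<dots> = (c * cnj c) * cinner x x"
    by (simp only: cinner_scaleC_left cinner_scaleC_right mult_ac)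
  also have "\<dots> = complex_of_real ((cmod c * norm x)\<^sup>2)"
    by (simp add: cinner_self power_mult_distrib flip: complex_norm_square)
  finally have "(norm (c *\<^sub>C x))\<^sup>2 = (cmod c * norm x)\<^sup>2"
    by (simp only: of_real_eq_iff)
  then show ?thesis by simp
qed

text \<open>Supplies the continuity of multiplication by \<open>- \<i>\<close>, which turns the
  imaginary part of the inner product into a real part.\<close>

lemma bounded_linear_scaleC: "bounded_linear (scaleC c :: 'a::complex_hilbert \<Rightarrow> 'a)"
  by (rule bounded_linear_intro[of _ "cmod c"])
    (simp_all add: scaleC_add_right scaleR_scaleC scaleC_scaleC norm_scaleC mult.commute)

lemma continuous_on_Omega [continuous_intros]:
  fixes f g :: "'b::topological_space \<Rightarrow> 'a::complex_hilbert"
  assumes "continuous_on S f" "continuous_on S g"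
  shows "continuous_on S (\<lambda>x. Omega (f x) (g x))"
proof -
  (* polarization, using Im <a, b> = Re <- i a, b> *)
  have eq: "Omega a b = ((norm ((- \<i>) *\<^sub>C a))\<^sup>2 + (norm b)\<^sup>2 - (norm ((- \<i>) *\<^sub>C a - b))\<^sup>2) / 2"
    for a b :: 'a
    by (simp add: norm_diff_sqr Omega_def cinner_scaleC_left)
  show ?thesis
    unfolding eq
    by (intro continuous_intros bounded_linear.continuous_on[OF bounded_linear_scaleC] assms) simp
qed

theorem proposition3p12:
  assumes infinite_dimensional:
    "\<not> (\<exists>B. finite_dimensional_vector_space (scaleC :: complex \<Rightarrow> 'a \<Rightarrow> 'a::complex_hilbert) B)"
  shows "conditionally_negative_type
    (heisenberg_dist :: 'a \<times> real \<Rightarrow> 'a \<times> real \<Rightarrow> real)"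
  unfolding conditionally_negative_type_def
proof (intro conjI allI impI)
  show "continuous_on UNIV (\<lambda>(x :: 'a \<times> real, y). heisenberg_dist x y)"
  proof -
    \<comment> \<open>The points are spelled out as pairs so that the explicit distance formula can
      rewrite them.\<close>
    have "continuous_on UNIV (\<lambda>p :: ('a \<times> real) \<times> ('a \<times> real).
        heisenberg_dist (fst (fst p), snd (fst p)) (fst (snd p), snd (snd p)))"
      unfolding heisenberg_dist_eq by (intro continuous_intros)
    then show ?thesis
      by (simp add: case_prod_beta)
  qed
  fix x y :: "'a \<times> real"
  show "heisenberg_dist x x = 0"
    by (cases x) (simp add: heisenberg_dist_eq Omega_self)
  show "heisenberg_dist x y = heisenberg_dist y x"
  proof -
    obtain a t b s where xy: "x = (a, t)" "y = (b, s)" by force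
    \<comment> \<open>Antisymmetry of \<open>Omega\<close> makes the whole bracket change sign when
      the points are exchanged.\<close>
    have "(t - s - 2 * Omega a b)\<^sup>2 = (s - t - 2 * Omega b a)\<^sup>2"
      unfolding Omega_swap[of b a] by (simp add: power2_eq_square algebra_simps)
    then show ?thesis
      unfolding xy heisenberg_dist_eq by (simp add: norm_minus_commute)
  qed
next
  fix n :: nat and x :: "nat \<Rightarrow> 'a \<times> real" and c :: "nat \<Rightarrow> real"
  assume c: "sum c {1..n} = 0"
  have "(\<Sum>i=1..n. \<Sum>j=1..n. c i * c j * Re (csqrt (heisenberg_kernel (x i) (x j)))) \<le> 0"
  proof (rule sum_Re_csqrt_le[OF psd_on_exp_heisenberg_kernel _ c])
    show "0 \<le> Re (heisenberg_kernel (x i) (x j))" for i j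
      by (cases "x i"; cases "x j") (simp add: Re_heisenberg_kernel)
  qed auto
  then have "sqrt 2 *
      (\<Sum>i=1..n. \<Sum>j=1..n. c i * c j * Re (csqrt (heisenberg_kernel (x i) (x j)))) \<le> 0"
    by (simp add: mult_nonneg_nonpos del: csqrt.simps)
  then show "(\<Sum>i=1..n. \<Sum>j=1..n. c i * c j * heisenberg_dist (x i) (x j)) \<le> 0"
    unfolding heisenberg_dist_conv_kernel sum_distrib_left by (simp add: mult_ac del: csqrt.simps)
qed

end
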